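(* Let $|q|<1$, $|\rho|<1$ and $|x|,|y|<\frac{2}{\sqrt{1-q}}$. Then $$f_N(x|q)=f_{CN}(x|y,\rho,q)\sum_{n=0}^{\infty}\frac{\rho^n}{(\rho^2)_n\,[n]_q!}\,B_n(y|q)\,P_n(x|y,\rho,q).$$
   Context: Notation: $[0]_q=0$, $[n]_q=1+q+\dots+q^{n-1}$, $[n]_q!=\prod_{i=1}^n[i]_q$, $[0]_q!=1$; $(a)_n=\prod_{i=0}^{n-1}(1-aq^i)$, $(a)_0=1$, $(a)_\infty=\prod_{i\ge0}(1-aq^i)$; $0^0=1$. The densities are $$f_N(x|q)=\frac{\sqrt{1-q}\,(q)_\infty}{2\pi\sqrt{4-(1-q)x^2}}\prod_{k=0}^\infty\left((1+q^k)^2-(1-q)x^2q^k\right),$$ $$f_{CN}(x|y,\rho,q)=\frac{\sqrt{1-q}\,(\rho^2)_\infty(q)_\infty}{2\pi\sqrt{4-(1-q)x^2}}\prod_{k=0}^\infty\frac{(1+q^k)^2-(1-q)x^2q^k}{(1-\rho^2q^{2k})^2-(1-q)\rho q^k(1+\rho^2q^{2k})xy+(1-q)\rho^2(x^2+y^2)q^{2k}}.$$ The polynomials are defined by: $P_{-1}(x|y,\rho,q)=0$, $P_0(x|y,\rho,q)=1$, $P_{n+1}(x|y,\rho,q)=(x-\rho yq^n)P_n(x|y,\rho,q)-(1-\rho^2q^{n-1})[n]_qP_{n-1}(x|y,\rho,q)$ (Al-Salam--Chihara polynomials); and $B_{-1}(y|q)=0$, $B_0(y|q)=1$, $B_{n+1}(y|q)=-q^nyB_n(y|q)+q^{n-1}[n]_qB_{n-1}(y|q)$,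 $n\ge0$ (for $n=0$ the last terms in both recursions are $0$). *)

theory Defs
  imports "HOL-Analysis.Analysis"
begin

definition qint :: "real \<Rightarrow> nat \<Rightarrow> real" where
  "qint q n = (\<Sum>i<n. q ^ i)"

definition qfact :: "real \<Rightarrow> nat \<Rightarrow> real" where
  "qfact q n = (\<Prod>i=1..n. qint q i)"

definition qpoch :: "real \<Rightarrow> real \<Rightarrow> nat \<Rightarrow> real" where
  "qpoch q a n = (\<Prod>i<n. 1 - a * q ^ i)"

definition qpoch_inf :: "real \<Rightarrow> real \<Rightarrow> real" where
  "qpoch_inf q a = (\<Prod>i. 1 - a * q ^ i)"

definition f_N :: "real \<Rightarrow> real \<Rightarrow> real" where
  "f_N q x =
     sqrt (1 - q) * qpoch_inf q q / (2 * pi * sqrt (4 - (1 - q) * x\<^sup>2)) *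
     (\<Prod>k. (1 + q ^ k)\<^sup>2 - (1 - q) * x\<^sup>2 * q ^ k)"

definition f_CN :: "real \<Rightarrow> real \<Rightarrow> real \<Rightarrow> real \<Rightarrow> real" where
  "f_CN q \<rho> y x =
     sqrt (1 - q) * qpoch_inf q (\<rho>\<^sup>2) * qpoch_inf q q / (2 * pi * sqrt (4 - (1 - q) * x\<^sup>2)) *
     (\<Prod>k. ((1 + q ^ k)\<^sup>2 - (1 - q) * x\<^sup>2 * q ^ k) /
           ((1 - \<rho>\<^sup>2 * q ^ (2 * k))\<^sup>2
            - (1 - q) * \<rho> * q ^ k * (1 + \<rho>\<^sup>2 * q ^ (2 * k)) * x * y
            + (1 - q) * \<rho>\<^sup>2 * (x\<^sup>2 + y\<^sup>2) * q ^ (2 * k)))"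

(* Three-term recursions started at index -1 with value 0. The step from index 0
   to 1, where the last term vanishes since [0]_q = 0, is the second equation of
   each; the third equation is the recursion with n replaced by n + 1, which keeps
   the exponent n - 1 nonnegative. *)

fun al_salam_chihara :: "real \<Rightarrow> real \<Rightarrow> real \<Rightarrow> nat \<Rightarrow> real \<Rightarrow> real" where
  "al_salam_chihara q \<rho> y 0 x = 1"
| "al_salam_chihara q \<rho> y (Suc 0) x = x - \<rho> * y"
| "al_salam_chihara q \<rho> y (Suc (Suc n)) x =
     (x - \<rho> * y * q ^ Suc n) * al_salam_chihara q \<rho> y (Suc n) x
     - (1 - \<rho>\<^sup>2 * q ^ n) * qint q (Suc n) * al_salam_chihara q \<rho> y n x"

fun B_poly :: "real \<Rightarrow> nat \<Rightarrow> real \<Rightarrow> real" where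
  "B_poly q 0 y = 1"
| "B_poly q (Suc 0) y = - y"
| "B_poly q (Suc (Suc n)) y =
     - (q ^ Suc n) * y * B_poly q (Suc n) y + q ^ n * qint q (Suc n) * B_poly q n y"

end

theory Submission imports Defs begin

text \<open>Write \<open>S(\<rho>)\<close> for the series and \<open>D(\<rho>)\<close> for the \<open>k = 0\<close> factor of the denominator of
  \<open>f_CN\<close>. The claim is \<open>(\<rho>\<^sup>2)\<^sub>\<infinity> S(\<rho>) = \<Prod>k. D(q\<^sup>k \<rho>)\<close>. It follows by iteration from the
  functional equation \<open>(1 - \<rho>\<^sup>2) (1 - \<rho>\<^sup>2 q) S(\<rho>) = D(\<rho>) S(q\<rho>)\<close> and \<open>S(q\<^sup>N \<rho>) \<longlonglongrightarrow> 1\<close>.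
  For the functional equation, both sides are expanded in the polynomials \<open>P\<^sub>n(x|y,q\<rho>,q)\<close>:
  on the left each \<open>P\<^sub>n(x|y,\<rho>,q)\<close> is a combination of three of them, and on the right \<open>D(\<rho>)\<close> is
  quadratic in \<open>x\<close>, so that the three-term recursion applies. The coefficients then agree by the
  recursion of \<open>B\<^sub>n\<close>. All rearrangements are justified because \<open>B\<^sub>n / [n]!\<close> decays faster than
  any geometric sequence while \<open>P\<^sub>n\<close> and \<open>1 / (\<rho>\<^sup>2)\<^sub>n\<close> grow at most geometrically.\<close>

section \<open>Identities and uniform bounds for q-integers, q-factorials and q-Pochhammer
  symbols\<close>

lemma qint_0 [simp]: "qint q 0 = 0"
  by (simp add: qint_def)

lemma qint_Suc: "qint q (Suc n) = qint q n + q ^ n"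
  by (simp add: qint_def)

lemma one_minus_mult_qint: "(1 - q) * qint q n = 1 - q ^ n"
  by (simp add: qint_def one_diff_power_eq)

lemma qfact_0 [simp]: "qfact q 0 = 1"
  by (simp add: qfact_def)

lemma qfact_Suc: "qfact q (Suc n) = qfact q n * qint q (Suc n)"
  by (simp add: qfact_def)

lemma qpoch_0 [simp]: "qpoch q a 0 = 1"
  by (simp add: qpoch_def)

lemma qpoch_Suc: "qpoch q a (Suc n) = qpoch q a n * (1 - a * q ^ n)"
  by (simp add: qpoch_def)

lemma qpoch_Suc_shift: "qpoch q a (Suc n) = (1 - a) * qpoch q (a * q) n"
  unfolding qpoch_def by (simp add: prod.lessThan_Suc_shift mult.assoc del: prod.lessThan_Suc)

lemma power_abs_less_one:
  fixes q :: real
  assumes "\<bar>q\<bar> < 1"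
  shows "\<bar>q ^ n\<bar> \<le> 1" "\<bar>q ^ Suc n\<bar> \<le> \<bar>q\<bar>"
  using assms by (simp_all add: power_abs power_le_one mult_left_le abs_mult)

text \<open>In the closed form \<open>(1 - q ^ n) / (1 - q)\<close> the denominator lies between
  \<open>1 - \<bar>q\<bar>\<close> and 2. The numerator is at most 2 in absolute value, and at least
  \<open>1 - \<bar>q\<bar>\<close> for positive index. The bounds do not depend on \<open>n\<close>,
  and \<open>q\<close> may be negative.\<close>

lemma qint_bounds:
  assumes "\<bar>q\<bar> < 1"
  shows "\<bar>qint q n\<bar> \<le> 2 / (1 - \<bar>q\<bar>)" "(1 - \<bar>q\<bar>) / 2 \<le> qint q (Suc n)"
proof -
  have eq: "qint q n = (1 - q ^ n) / (1 - q)" for n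
    using one_minus_mult_qint[of q n] assms by (simp add: field_simps)
  have "\<bar>qint q n\<bar> = \<bar>1 - q ^ n\<bar> / (1 - q)"
    using assms by (simp add: eq)
  also have "\<dots> \<le> 2 / (1 - \<bar>q\<bar>)"
    using power_abs_less_one[OF assms, of n] assms by (intro frac_le) auto
  finally show "\<bar>qint q n\<bar> \<le> 2 / (1 - \<bar>q\<bar>)" .
  have "(1 - \<bar>q\<bar>) / 2 \<le> (1 - q ^ Suc n) / (1 - q)"
    using power_abs_less_one(2)[OF assms, of n] assms by (intro frac_le) auto
  then show "(1 - \<bar>q\<bar>) / 2 \<le> qint q (Suc n)"
    by (simp only: eq)
qed

lemma qint_Suc_pos:
  assumes "\<bar>q\<bar> < 1"
  shows "qint q (Suc n) > 0"
  using qint_bounds(2)[OF assms, of n] assms by (auto intro: less_le_trans[rotated])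

lemma qfact_pos:
  assumes "\<bar>q\<bar> < 1"
  shows "qfact q n > 0"
  by (induction n) (simp_all add: qfact_Suc qint_Suc_pos[OF assms])

lemma abs_mult_power_le:
  fixes a q :: real
  assumes "\<bar>q\<bar> < 1"
  shows "\<bar>a * q ^ n\<bar> \<le> \<bar>a\<bar>"
  using power_abs_less_one(1)[OF assms, of n] by (simp add: abs_mult mult_left_le)

text \<open>The bound \<open>b\<close> is kept apart from \<open>a\<close> so that one estimate
  serves all parameters \<open>a\<close> of a given size, such as the squares of all
  \<open>q ^ N * \<rho>\<close>.\<close>

lemma qpoch_lower_bound:
  assumes "\<bar>q\<bar> < 1" "\<bar>a\<bar> \<le> b" "b < 1"
  shows "(1 - b) ^ n \<le> qpoch q a n"
proof (induction n)
  case (Suc n)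
  have "1 - b \<le> 1 - a * q ^ n"
    using abs_mult_power_le[OF assms(1), of a n] assms(2) by linarith
  with Suc have "(1 - b) ^ n * (1 - b) \<le> qpoch q a n * (1 - a * q ^ n)"
    using assms by (intro mult_mono) (auto intro: order_trans[OF _ Suc])
  then show ?case
    by (simp add: qpoch_Suc mult.commute)
qed simp

lemma qpoch_pos:
  assumes "\<bar>q\<bar> < 1" "\<bar>a\<bar> < 1"
  shows "qpoch q a n > 0"
  using qpoch_lower_bound[OF assms(1) order_refl assms(2), of n] assms(2)
  by (auto intro: less_le_trans[rotated])

section \<open>Sequences decaying faster than every geometric sequence\<close>

text \<open>This class is closed under products with geometrically growing sequences, so no relation
  between decay and growth rates has to be tracked.\<close>

definition superexp_small :: "(nat \<Rightarrow> real) \<Rightarrow> bool" where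
  "superexp_small a \<longleftrightarrow> (\<forall>r>0. \<exists>C. \<forall>n. \<bar>a n\<bar> \<le> C * r ^ n)"

lemma superexp_smallE:
  assumes "superexp_small a" "r > 0"
  obtains C where "C \<ge> 0" "\<And>n. \<bar>a n\<bar> \<le> C * r ^ n"
proof -
  obtain C where C: "\<And>n. \<bar>a n\<bar> \<le> C * r ^ n"
    using assms unfolding superexp_small_def by blast
  moreover have "C \<ge> 0"
    using order_trans[OF abs_ge_zero C[of 0]] by simp
  ultimately show thesis
    using that by blast
qed

lemma superexp_small_add:
  assumes "superexp_small a" "superexp_small b"
  shows "superexp_small (\<lambda>n. a n + b n)"
  unfolding superexp_small_def
proof (intro allI impI)
  fix r :: real assume r: "r > 0"
  obtain C where "\<And>n. \<bar>a n\<bar> \<le> C * r ^ n" using superexp_smallE[OF assms(1) r] by blast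
  moreover obtain D where "\<And>n. \<bar>b n\<bar> \<le> D * r ^ n" using superexp_smallE[OF assms(2) r] by blast
  ultimately have "\<bar>a n + b n\<bar> \<le> (C + D) * r ^ n" for n
    by (smt (verit) distrib_right)
  then show "\<exists>C. \<forall>n. \<bar>a n + b n\<bar> \<le> C * r ^ n" by blast
qed

lemma superexp_small_mult:
  assumes "superexp_small a" "K > 0" "\<And>n. \<bar>c n\<bar> \<le> M * K ^ n"
  shows "superexp_small (\<lambda>n. c n * a n)"
  unfolding superexp_small_def
proof (intro allI impI)
  fix r :: real assume r: "r > 0"
  with assms(2) have "r / K > 0" by simp
  from superexp_smallE[OF assms(1) this]
  obtain C where C: "C \<ge> 0" "\<And>n. \<bar>a n\<bar> \<le> C * (r / K) ^ n" by metis
  have "\<bar>c n * a n\<bar> \<le> (M * C) * r ^ n" for n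
  proof -
    have "\<bar>c n * a n\<bar> \<le> (M * K ^ n) * (C * (r / K) ^ n)"
      unfolding abs_mult using assms(3)[of n] C(2)[of n]
      by (intro mult_mono) (auto intro: order_trans[OF abs_ge_zero])
    also have "\<dots> = (M * C) * r ^ n"
      using assms(2) by (simp add: power_divide)
    finally show ?thesis .
  qed
  then show "\<exists>C. \<forall>n. \<bar>c n * a n\<bar> \<le> C * r ^ n" by blast
qed

lemma superexp_small_Suc:
  assumes "superexp_small a"
  shows "superexp_small (\<lambda>n. a (Suc n))"
  unfolding superexp_small_def
proof (intro allI impI)
  fix r :: real assume r: "r > 0"
  obtain C where C: "\<And>n. \<bar>a n\<bar> \<le> C * r ^ n" using superexp_smallE[OF assms r] by blast
  then have "\<bar>a (Suc n)\<bar> \<le> (C * r) * r ^ n" for n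
    using C[of "Suc n"] by (simp add: mult_ac)
  then show "\<exists>C. \<forall>n. \<bar>a (Suc n)\<bar> \<le> C * r ^ n" by blast
qed

lemma superexp_small_summable:
  assumes "superexp_small a" "K > 0" "\<And>n. \<bar>p n\<bar> \<le> M * K ^ n"
  shows "summable (\<lambda>n. a n * p n)"
proof -
  have "superexp_small (\<lambda>n. p n * a n)"
    by (rule superexp_small_mult) (use assms in auto)
  then obtain C where C: "\<And>n. \<bar>p n * a n\<bar> \<le> C * (1/2) ^ n"
    using superexp_smallE[of "\<lambda>n. p n * a n" "1/2"] by auto
  show ?thesis
    by (rule summable_comparison_test'[where g = "\<lambda>n. C * (1/2) ^ n" and N = 0])
       (use C in \<open>auto intro!: summable_mult summable_geometric simp: mult.commute\<close>)
qed

text \<open>For a given \<open>r\<close>, the factor \<open>q ^ n\<close> eventually makes the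
  recursion contract so strongly that a bound \<open>C * r ^ n\<close> propagates; the finitely many
  earlier terms only enlarge \<open>C\<close>.\<close>

lemma superexp_small_two_step:
  fixes b :: "nat \<Rightarrow> real"
  assumes q: "0 \<le> q" "q < 1" and M: "M \<ge> 0"
    and step: "\<And>n. \<bar>b (Suc (Suc n))\<bar> \<le> M * q ^ n * (\<bar>b (Suc n)\<bar> + \<bar>b n\<bar>)"
  shows "superexp_small b"
  unfolding superexp_small_def
proof (intro allI impI)
  fix r :: real assume r: "r > 0"
  \<comment> \<open>The inductive step turns
    \<open>C * r ^ Suc m + C * r ^ m = (r + 1) * (C * r ^ m)\<close> into a bound by
    \<open>r^2 * (C * r ^ m)\<close>, so \<open>M * q ^ n * (r + 1) < r^2\<close> is what is needed
    from some index on.\<close>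
  have "(\<lambda>n. M * q ^ n * (r + 1)) \<longlonglongrightarrow> M * 0 * (r + 1)"
    by (intro tendsto_intros LIMSEQ_realpow_zero) (use q in auto)
  then have "eventually (\<lambda>n. M * q ^ n * (r + 1) < r\<^sup>2) sequentially"
    by (rule order_tendstoD(2)) (use r in auto)
  then obtain n0 where n0: "\<And>n. n \<ge> n0 \<Longrightarrow> M * q ^ n * (r + 1) < r\<^sup>2"
    by (auto simp: eventually_sequentially)
  \<comment> \<open>The sum replaces a maximum of the initial ratios. It runs to
    \<open>Suc n0\<close> because the recursion first becomes usable for the term of index
    \<open>n0 + 2\<close>.\<close>
  define C where "C = (\<Sum>k\<le>Suc n0. \<bar>b k\<bar> / r ^ k)"
  have C0: "C \<ge> 0" unfolding C_def using r by (intro sum_nonneg) auto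
  have "\<bar>b n\<bar> \<le> C * r ^ n" for n
  proof (induction n rule: less_induct)
    case (less n)
    show ?case
    proof (cases "n \<le> Suc n0")
      case True
      then have "\<bar>b n\<bar> / r ^ n \<le> C"
        unfolding C_def using r by (intro member_le_sum) auto
      with r show ?thesis by (simp add: field_simps)
    next
      case False
      then obtain m where n: "n = Suc (Suc m)" and m: "m \<ge> n0"
        by (metis not_less_eq_eq le_SucE Suc_le_D nat_le_linear Suc_le_mono)
      have "\<bar>b n\<bar> \<le> M * q ^ m * (C * r ^ Suc m + C * r ^ m)"
        unfolding n using less[of m] less[of "Suc m"] n q M
        by (intro order_trans[OF step] mult_left_mono add_mono) auto
      also have "\<dots> = (M * q ^ m * (r + 1)) * (C * r ^ m)"
        by (simp add: algebra_simps)
      also have "\<dots> \<le> r\<^sup>2 * (C * r ^ m)"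
        using n0[OF m] C0 r by (intro mult_right_mono) auto
      finally show ?thesis
        unfolding n by (simp add: power2_eq_square mult_ac)
    qed
  qed
  then show "\<exists>C. \<forall>n. \<bar>b n\<bar> \<le> C * r ^ n" by blast
qed

section \<open>Decay of \<open>B_poly\<close> over \<open>qfact\<close> and growth of the
  Al-Salam--Chihara polynomials\<close>

text \<open>Division by the factorial turns the recursion into
  \<open>b (n+2) = q ^ n * (- q * y * b (n+1) + b n) / qint q (n+2)\<close>. The factor
  \<open>q ^ n\<close> gives the decay, and the q-integers are bounded away from 0.\<close>

lemma B_poly_div_qfact_superexp_small:
  assumes q: "\<bar>q\<bar> < 1"
  shows "superexp_small (\<lambda>n. B_poly q n y / qfact q n)"
proof -
  define M where "M = (2 / (1 - \<bar>q\<bar>)) * (\<bar>y\<bar> + 1)"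
  have M0: "M \<ge> 0" unfolding M_def using q by auto
  define b where "b = (\<lambda>n. B_poly q n y / qfact q n)"
  have "\<bar>b (Suc (Suc n))\<bar> \<le> M * \<bar>q\<bar> ^ n * (\<bar>b (Suc n)\<bar> + \<bar>b n\<bar>)" for n
  proof -
    have nz: "qint q (Suc n) \<noteq> 0" "qint q (Suc (Suc n)) \<noteq> 0" "qfact q n \<noteq> 0"
      using qint_Suc_pos[OF q] qfact_pos[OF q] less_numeral_extra(3) by metis+
    have "b (Suc (Suc n)) = (- (q ^ Suc n) * y * b (Suc n) + q ^ n * b n) / qint q (Suc (Suc n))"
      using nz by (simp add: b_def qfact_Suc field_simps)
    then have "\<bar>b (Suc (Suc n))\<bar> = \<bar>q\<bar> ^ n * \<bar>- (q * y) * b (Suc n) + b n\<bar> * (1 / qint q (Suc (Suc n)))"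
      using qint_Suc_pos[OF q, of "Suc n"]
      by (simp add: abs_mult power_abs[symmetric] flip: abs_mult) (simp add: algebra_simps)
    also have "\<dots> \<le> \<bar>q\<bar> ^ n * ((\<bar>y\<bar> + 1) * (\<bar>b (Suc n)\<bar> + \<bar>b n\<bar>)) * (2 / (1 - \<bar>q\<bar>))"
    proof (intro mult_mono)
      have "\<bar>q * y\<bar> \<le> \<bar>y\<bar>" using q by (simp add: abs_mult mult_left_le_one_le)
      then have "\<bar>q * y\<bar> * \<bar>b (Suc n)\<bar> \<le> \<bar>y\<bar> * \<bar>b (Suc n)\<bar>" by (intro mult_right_mono) auto
      moreover have "\<bar>- (q * y) * b (Suc n) + b n\<bar> \<le> \<bar>q * y\<bar> * \<bar>b (Suc n)\<bar> + \<bar>b n\<bar>"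
        by (metis abs_minus_cancel abs_mult abs_triangle_ineq)
      moreover have "0 \<le> \<bar>y\<bar> * \<bar>b n\<bar>" by simp
      ultimately show "\<bar>- (q * y) * b (Suc n) + b n\<bar> \<le> (\<bar>y\<bar> + 1) * (\<bar>b (Suc n)\<bar> + \<bar>b n\<bar>)"
        by (simp only: distrib_left distrib_right) linarith
      show "1 / qint q (Suc (Suc n)) \<le> 2 / (1 - \<bar>q\<bar>)"
        using qint_bounds(2)[OF q, of "Suc n"] qint_Suc_pos[OF q, of "Suc n"] q
        by (simp add: field_simps)
    qed (use q qint_Suc_pos[OF q, of "Suc n"] in auto)
    finally show ?thesis unfolding M_def by (simp only: mult_ac)
  qed
  then have "superexp_small b"
    using q by (intro superexp_small_two_step[OF _ _ M0]) auto
  then show ?thesis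
    by (simp add: b_def)
qed

text \<open>The coefficients of the three-term recursion are bounded uniformly in \<open>n\<close>
  and \<rho>. That \<open>K\<close> is independent of \<rho> is needed for the limit along
  \<open>q ^ N * \<rho>\<close>.\<close>

lemma al_salam_chihara_bound:
  assumes q: "\<bar>q\<bar> < 1"
  obtains K where "K > 0" "\<And>\<rho> n. \<bar>\<rho>\<bar> < 1 \<Longrightarrow> \<bar>al_salam_chihara q \<rho> y n x\<bar> \<le> K ^ n"
proof
  define A where "A = \<bar>x\<bar> + \<bar>y\<bar>"
  define G where "G = 2 * (2 / (1 - \<bar>q\<bar>))"
  \<comment> \<open>\<open>K \<ge> 1\<close> and \<open>K \<ge> A + G\<close> yield
    \<open>A * K + G \<le> (A + G) * K \<le> K^2\<close>, which closes the induction.\<close>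
  define K where "K = 1 + A + G"
  have AG: "A \<ge> 0" "G \<ge> 0" using q by (auto simp: A_def G_def)
  show K: "K > 0" using AG by (simp add: K_def)
  show "\<bar>al_salam_chihara q \<rho> y n x\<bar> \<le> K ^ n" if \<rho>: "\<bar>\<rho>\<bar> < 1" for \<rho> n
  proof (induction n rule: induct_nat_012)
    have \<rho>y: "\<bar>\<rho> * y\<bar> \<le> \<bar>y\<bar>" using \<rho> by (simp add: abs_mult mult_left_le_one_le)
    {
      case 1
      show ?case using \<rho>y AG by (simp add: K_def A_def)
    next
      case (ge2 n)
      have "\<bar>x - \<rho> * y * q ^ Suc n\<bar> \<le> A"
        using abs_mult_power_le[OF q, of "\<rho> * y" "Suc n"] \<rho>y unfolding A_def by linarith
      moreover have "\<bar>(1 - \<rho>\<^sup>2 * q ^ n) * qint q (Suc n)\<bar> \<le> G"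
        unfolding abs_mult G_def
      proof (intro mult_mono qint_bounds q)
        have "\<rho>\<^sup>2 \<le> 1" using \<rho> by (simp add: abs_square_le_1)
        then show "\<bar>1 - \<rho>\<^sup>2 * q ^ n\<bar> \<le> 2"
          using abs_mult_power_le[OF q, of "\<rho>\<^sup>2" n] by auto
      qed auto
      moreover have "\<bar>a * b - c * d\<bar> \<le> \<bar>a\<bar> * \<bar>b\<bar> + \<bar>c\<bar> * \<bar>d\<bar>" for a b c d :: real
        by (metis abs_mult abs_triangle_ineq4)
      ultimately have "\<bar>al_salam_chihara q \<rho> y (Suc (Suc n)) x\<bar> \<le> A * K ^ Suc n + G * K ^ n"
        unfolding al_salam_chihara.simps using ge2 AG
        by (intro order_trans[OF \<open>\<And>d c b a. \<bar>a * b - c * d\<bar> \<le> \<bar>a\<bar> * \<bar>b\<bar> + \<bar>c\<bar> * \<bar>d\<bar>\<close>]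
            add_mono mult_mono) auto
      also have "\<dots> \<le> (A * K + G * K) * K ^ n"
        using AG K by (simp add: algebra_simps K_def mult_left_mono)
      also have "\<dots> \<le> K\<^sup>2 * K ^ n"
        using AG K by (intro mult_right_mono) (auto simp: K_def power2_eq_square algebra_simps)
      finally show ?case by (simp add: power2_eq_square)
    }
  qed auto
qed

section \<open>Change of parameter from \<rho> to \<open>q * \<rho>\<close>, and multiplication by
  \<open>x\<close>\<close>

text \<open>At \<open>n = 0\<close> the truncated index \<open>n - 1\<close> is harmless because
  \<open>qint q 0 = 0\<close>, so one formula covers all \<open>n\<close>.\<close>

lemma al_salam_chihara_shift_rec:
  "al_salam_chihara q (q * \<rho>) y (Suc n) x =
     (x - \<rho> * y * q ^ Suc n) * al_salam_chihara q (q * \<rho>) y n x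
     - (1 - \<rho>\<^sup>2 * q ^ Suc n) * qint q n * al_salam_chihara q (q * \<rho>) y (n - 1) x"
  by (cases n) (simp_all add: power2_eq_square algebra_simps)

text \<open>The inductive step of the connection formula, with \<open>Q\<close> for
  \<open>q ^ n\<close>, \<open>N\<close> and \<open>M\<close> for the q-integers of \<open>n\<close>
  and \<open>n - 1\<close>, and \<open>b\<close>, \<open>c\<close>, \<open>d\<close> for the
  polynomials of index \<open>n\<close>, \<open>n - 1\<close>, \<open>n - 2\<close> at
  \<open>q * \<rho>\<close>. The recursion for \<open>b\<close> is multiplied by \<open>N\<close> so
  that it also holds at \<open>n = 0\<close>.\<close>

lemma al_salam_chihara_connection_step_identity:
  fixes b c d q Q N M x y r :: real
  assumes "N * b = N * ((x - r * y * Q) * c - (1 - r * r * Q) * M * d)" "(1 - q) * N = 1 - Q"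
  shows "(x - r * y * q * q * Q) * ((x - r * y * q * Q) * b - (1 - r * r * q * Q) * N * c)
      - (1 - r * r * q * q * Q) * (N + Q) * b
      - (1 - q) * r * y * (N + Q + q * Q) * ((x - r * y * q * Q) * b - (1 - r * r * q * Q) * N * c)
     + (1 - q) * (r * r) * (N + Q + q * Q) * (N + Q) * b =
     (x - r * y * (q * Q)) *
       (((x - r * y * q * Q) * b - (1 - r * r * q * Q) * N * c) - (1 - q) * r * y * (N + Q) * b
        + (1 - q) * (r * r) * (N + Q) * N * c) -
     (1 - r * r * Q) * (N + Q) *
      (b - (1 - q) * r * y * N * c + (1 - q) * (r * r) * N * M * d)"
proof -
  have Q: "Q = 1 - (1 - q) * N" using assms(2) by simp
  show ?thesis using assms(1) unfolding Q by algebra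
qed

text \<open>In terms of generating functions: the one for \<open>q * \<rho>\<close> is that for \<open>\<rho>\<close> divided by
  a quadratic polynomial in the formal variable.\<close>
lemma al_salam_chihara_connection:
  "al_salam_chihara q \<rho> y n x =
     al_salam_chihara q (q * \<rho>) y n x
     - (1 - q) * \<rho> * y * qint q n * al_salam_chihara q (q * \<rho>) y (n - 1) x
     + (1 - q) * \<rho>\<^sup>2 * qint q n * qint q (n - 1) * al_salam_chihara q (q * \<rho>) y (n - 2) x"
proof (induction n rule: induct_nat_012)
  case 0
  show ?case by simp
next
  case 1
  show ?case by (simp add: qint_Suc algebra_simps)
next
  case (ge2 n)
  define p where "p = (\<lambda>n. al_salam_chihara q (q * \<rho>) y n x)"
  have rec: "p (Suc n) = (x - \<rho> * y * q ^ Suc n) * p n - (1 - \<rho>\<^sup>2 * q ^ Suc n) * qint q n * p (n - 1)" for n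
    unfolding p_def by (rule al_salam_chihara_shift_rec)
  have rec1: "qint q n * p n =
      qint q n * ((x - \<rho> * y * q ^ n) * p (n - 1) - (1 - \<rho>\<^sup>2 * q ^ n) * qint q (n - 1) * p (n - 2))"
    using rec[of "n - 1"] by (cases n) (simp_all add: numeral_2_eq_2)
  have rec2: "p (Suc (Suc n)) = (x - \<rho> * y * q * q * q ^ n) * p (Suc n)
      - (1 - \<rho>\<^sup>2 * q * q * q ^ n) * (qint q n + q ^ n) * p n"
    using rec[of "Suc n"] by (simp add: qint_Suc mult_ac)
  have rec3: "p (Suc n) = (x - \<rho> * y * q * q ^ n) * p n - (1 - \<rho>\<^sup>2 * q * q ^ n) * qint q n * p (n - 1)"
    using rec[of n] by (simp add: mult_ac)
  have N: "(1 - q) * qint q n = 1 - q ^ n" by (rule one_minus_mult_qint)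
  have "p (Suc (Suc n)) - (1 - q) * \<rho> * y * (qint q n + q ^ n + q * q ^ n) * p (Suc n)
     + (1 - q) * \<rho>\<^sup>2 * (qint q n + q ^ n + q * q ^ n) * (qint q n + q ^ n) * p n =
     (x - \<rho> * y * (q * q ^ n)) *
       (p (Suc n) - (1 - q) * \<rho> * y * (qint q n + q ^ n) * p n
        + (1 - q) * \<rho>\<^sup>2 * (qint q n + q ^ n) * qint q n * p (n - 1)) -
     (1 - \<rho>\<^sup>2 * q ^ n) * (qint q n + q ^ n) *
      (p n - (1 - q) * \<rho> * y * qint q n * p (n - 1)
        + (1 - q) * \<rho>\<^sup>2 * qint q n * qint q (n - 1) * p (n - 2))"
    using rec1 N unfolding rec2 rec3 power2_eq_square by (rule al_salam_chihara_connection_step_identity)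
  then show ?case
    using ge2 by (simp add: p_def qint_Suc numeral_2_eq_2)
qed

text \<open>Multiplication by \<open>x\<close> acts on expansion coefficients by the adjoint of the three-term
  recursion.\<close>
lemma al_salam_chihara_expansion_mult_sums:
  assumes q: "\<bar>q\<bar> < 1" and \<rho>: "\<bar>\<rho>\<bar> < 1" and a: "superexp_small a"
  shows "(\<lambda>n. ((case n of 0 \<Rightarrow> 0 | Suc m \<Rightarrow> a m) + \<rho> * y * q ^ n * a n
             + (1 - \<rho>\<^sup>2 * q ^ n) * qint q (Suc n) * a (Suc n)) * al_salam_chihara q \<rho> y n x)
         sums (x * (\<Sum>n. a n * al_salam_chihara q \<rho> y n x))"
proof -
  define p where "p = (\<lambda>n. al_salam_chihara q \<rho> y n x)"
  obtain K where K: "K > 0" "\<And>n. \<bar>p n\<bar> \<le> K ^ n"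
    using al_salam_chihara_bound[OF q, of y x] \<rho> unfolding p_def by metis
  have p: "al_salam_chihara q \<rho> y n x = p n" for n
    by (simp add: p_def)
  define lo where "lo = (\<lambda>n. case n of 0 \<Rightarrow> 0 | Suc m \<Rightarrow> (1 - \<rho>\<^sup>2 * q ^ m) * qint q (Suc m) * p m)"
  have rec: "x * p n = p (Suc n) + \<rho> * y * q ^ n * p n + lo n" for n
    by (cases n) (simp_all add: p_def lo_def algebra_simps)
  have 0: "summable (\<lambda>n. a n * p n)"
    by (rule superexp_small_summable[OF a K(1), of _ 1]) (use K in auto)
  have 1: "summable (\<lambda>n. a n * p (Suc n))"
    by (rule superexp_small_summable[OF a K(1), of _ K]) (use K(2)[of "Suc _"] in auto)
  have 2: "summable (\<lambda>n. a n * (\<rho> * y * q ^ n * p n))"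
  proof (rule superexp_small_summable[OF a K(1)])
    show "\<bar>\<rho> * y * q ^ n * p n\<bar> \<le> \<bar>\<rho> * y\<bar> * K ^ n" for n
      unfolding abs_mult[of "_ * _ ^ _"]
      by (intro mult_mono abs_mult_power_le q K) auto
  qed
  \<comment> \<open>The recursion expresses this series through three series already known to
    converge, so \<open>lo\<close> needs no bound of its own.\<close>
  have 3: "summable (\<lambda>n. a n * lo n)"
  proof -
    have "a n * lo n = a n * (x * p n) - a n * p (Suc n) - a n * (\<rho> * y * q ^ n * p n)" for n
      by (simp only: rec) (simp add: algebra_simps)
    moreover have "summable (\<lambda>n. a n * (x * p n))"
      using summable_mult[OF 0, of x] by (simp add: mult_ac)
    ultimately show ?thesis
      using 1 2 by (auto intro!: summable_diff)
  qed
  \<comment> \<open>Reindexing: the raising term moves up by one, with a zero in front, and the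
    lowering term moves down by one, where the dropped initial term is zero as
    \<open>lo 0 = 0\<close>.\<close>
  have "(\<lambda>n. (case n of 0 \<Rightarrow> 0 | Suc m \<Rightarrow> a m) * p n) sums (\<Sum>n. a n * p (Suc n))"
    using sums_Suc[of "\<lambda>n. (case n of 0 \<Rightarrow> 0 | Suc m \<Rightarrow> a m) * p n"] summable_sums[OF 1] by simp
  moreover have "(\<lambda>n. a (Suc n) * lo (Suc n)) sums (\<Sum>n. a n * lo n)"
    using summable_sums[OF 3] by (subst sums_Suc_iff) (simp add: lo_def)
  ultimately have "(\<lambda>n. (case n of 0 \<Rightarrow> 0 | Suc m \<Rightarrow> a m) * p n + a n * (\<rho> * y * q ^ n * p n)
      + a (Suc n) * lo (Suc n)) sums
      ((\<Sum>n. a n * p (Suc n)) + (\<Sum>n. a n * (\<rho> * y * q ^ n * p n)) + (\<Sum>n. a n * lo n))"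
    using summable_sums[OF 2] by (intro sums_add)
  also have "(\<Sum>n. a n * p (Suc n)) + (\<Sum>n. a n * (\<rho> * y * q ^ n * p n)) + (\<Sum>n. a n * lo n)
      = (\<Sum>n. a n * (x * p n))"
    by (simp add: rec suminf_add[OF 1 2] suminf_add[OF summable_add[OF 1 2] 3] distrib_left)
  also have "\<dots> = x * (\<Sum>n. a n * p n)"
    using suminf_mult[OF 0, of x] by (simp add: mult_ac)
  finally show ?thesis
    unfolding p by (simp add: lo_def algebra_simps)
qed

section \<open>The series and its functional equation\<close>

definition recip_kernel_coeff :: "real \<Rightarrow> real \<Rightarrow> real \<Rightarrow> nat \<Rightarrow> real" where
  "recip_kernel_coeff q \<rho> y n = \<rho> ^ n / (qpoch q (\<rho>\<^sup>2) n * qfact q n) * B_poly q n y"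

text \<open>Up to the factor \<open>qpoch_inf q (\<rho>\<^sup>2)\<close>, this is the reciprocal of the Poisson--Mehler kernel.\<close>
definition recip_kernel :: "real \<Rightarrow> real \<Rightarrow> real \<Rightarrow> real \<Rightarrow> real" where
  "recip_kernel q \<rho> y x = (\<Sum>n. recip_kernel_coeff q \<rho> y n * al_salam_chihara q \<rho> y n x)"

text \<open>The base \<tau> is separate from \<sigma> since the functional equation pairs powers of
  \<rho> with the Pochhammer symbol of \<open>(q * \<rho>)^2\<close>. The geometric rate on the
  right depends on \<rho> and \<tau> only, hence is uniform in \<sigma>.\<close>

lemma power_div_qpoch_bound:
  assumes q: "\<bar>q\<bar> < 1" and \<sigma>: "\<bar>\<sigma>\<bar> \<le> \<bar>\<rho>\<bar>" "\<bar>\<rho>\<bar> < 1"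
  shows "\<bar>\<tau> ^ n / qpoch q (\<sigma>\<^sup>2) n\<bar> \<le> \<bar>\<tau>\<bar> ^ n * (1 / (1 - \<rho>\<^sup>2)) ^ n"
proof -
  have le: "\<sigma>\<^sup>2 \<le> \<rho>\<^sup>2" "\<rho>\<^sup>2 < 1"
    using \<sigma> by (simp_all add: abs_le_square_iff abs_square_less_1)
  then have "(1 - \<rho>\<^sup>2) ^ n \<le> qpoch q (\<sigma>\<^sup>2) n"
    by (intro qpoch_lower_bound q) auto
  moreover have "(1 - \<rho>\<^sup>2) ^ n > 0" using le by simp
  ultimately have "\<bar>\<tau>\<bar> ^ n / qpoch q (\<sigma>\<^sup>2) n \<le> \<bar>\<tau>\<bar> ^ n / (1 - \<rho>\<^sup>2) ^ n" "qpoch q (\<sigma>\<^sup>2) n > 0"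
    by (auto intro!: divide_left_mono)
  then show ?thesis
    by (simp add: power_abs power_divide)
qed

lemma recip_kernel_coeff_superexp_small:
  assumes q: "\<bar>q\<bar> < 1" and \<rho>: "\<bar>\<rho>\<bar> < 1"
  shows "superexp_small (recip_kernel_coeff q \<rho> y)"
proof -
  have "\<rho>\<^sup>2 < 1" using \<rho> by (simp add: abs_square_less_1)
  have "superexp_small (\<lambda>n. \<rho> ^ n / qpoch q (\<rho>\<^sup>2) n * (B_poly q n y / qfact q n))"
  proof (rule superexp_small_mult[OF B_poly_div_qfact_superexp_small[OF q]])
    show "0 < 1 / (1 - \<rho>\<^sup>2)" using \<open>\<rho>\<^sup>2 < 1\<close> by simp
    have "\<bar>\<rho>\<bar> ^ n * (1 / (1 - \<rho>\<^sup>2)) ^ n \<le> 1 * (1 / (1 - \<rho>\<^sup>2)) ^ n" for n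
      using \<rho> \<open>\<rho>\<^sup>2 < 1\<close> by (intro mult_right_mono) (auto simp: power_le_one)
    then show "\<bar>\<rho> ^ n / qpoch q (\<rho>\<^sup>2) n\<bar> \<le> 1 * (1 / (1 - \<rho>\<^sup>2)) ^ n" for n
      using power_div_qpoch_bound[OF q order_refl \<rho>, of \<rho> n] by (rule order_trans[rotated])
  qed
  then show ?thesis
    by (simp add: recip_kernel_coeff_def[abs_def])
qed

lemma superexp_small_qint_Suc:
  assumes q: "\<bar>q\<bar> < 1" and a: "superexp_small a"
  shows "superexp_small (\<lambda>n. qint q (Suc n) * a (Suc n))"
  by (rule superexp_small_mult[OF superexp_small_Suc[OF a], of 1]) (use qint_bounds(1)[OF q] in auto)

lemma recip_kernel_coeff_summable:
  assumes q: "\<bar>q\<bar> < 1" and \<rho>: "\<bar>\<rho>\<bar> < 1"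
  shows "summable (\<lambda>n. recip_kernel_coeff q \<rho> y n * al_salam_chihara q \<rho> y n x)"
proof -
  obtain K where "K > 0" "\<And>n. \<bar>al_salam_chihara q \<rho> y n x\<bar> \<le> 1 * K ^ n"
    using al_salam_chihara_bound[OF q, of y x] \<rho> by (metis mult_1)
  then show ?thesis
    by (rule superexp_small_summable[OF recip_kernel_coeff_superexp_small[OF q \<rho>]])
qed

text \<open>The connection formula is inserted into the series, and its second and third terms are
  shifted by one and by two indices, so that everything is expanded in the polynomials for
  \<open>q * \<rho>\<close>.\<close>

lemma recip_kernel_sums_shifted:
  fixes y :: real
  assumes q: "\<bar>q\<bar> < 1" and \<rho>: "\<bar>\<rho>\<bar> < 1"
  defines "u \<equiv> recip_kernel_coeff q \<rho> y"
  shows "(\<lambda>n. (u n - (1 - q) * \<rho> * y * (qint q (Suc n) * u (Suc n))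
           + (1 - q) * \<rho>\<^sup>2 * (qint q (Suc n) * (qint q (Suc (Suc n)) * u (Suc (Suc n)))))
           * al_salam_chihara q (q * \<rho>) y n x) sums recip_kernel q \<rho> y x"
proof -
  define p where "p = (\<lambda>n. al_salam_chihara q (q * \<rho>) y n x)"
  have p: "al_salam_chihara q (q * \<rho>) y n x = p n" for n
    by (simp add: p_def)
  have q\<rho>: "\<bar>q * \<rho>\<bar> < 1"
    using q \<rho> by (metis abs_ge_zero abs_mult mult_strict_mono' mult_1)
  obtain K where K: "K > 0" "\<And>n. \<bar>p n\<bar> \<le> 1 * K ^ n"
    using al_salam_chihara_bound[OF q, of y x] q\<rho> unfolding p_def by (metis mult_1)
  note summ = superexp_small_summable[OF _ K]
  define v where "v = (\<lambda>n. qint q (Suc n) * u (Suc n))"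
  define w where "w = (\<lambda>n. qint q (Suc n) * v (Suc n))"
  have u: "superexp_small u" unfolding u_def by (rule recip_kernel_coeff_superexp_small[OF q \<rho>])
  then have v: "superexp_small v" unfolding v_def by (rule superexp_small_qint_Suc[OF q])
  then have w: "superexp_small w" unfolding w_def by (rule superexp_small_qint_Suc[OF q])
  have 1: "(\<lambda>n. u n * p n) sums (\<Sum>n. u n * p n)"
    by (rule summable_sums[OF summ[OF u]])
  \<comment> \<open>The term at index 0 vanishes because \<open>qint q 0 = 0\<close>. The shift by
    two below is done in two such steps, passing through \<open>v\<close>.\<close>
  have 2: "(\<lambda>n. u n * (qint q n * p (n - 1))) sums (\<Sum>n. v n * p n)"
    using sums_Suc[of "\<lambda>n. u n * (qint q n * p (n - 1))"] summable_sums[OF summ[OF v]]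
    by (simp add: v_def mult_ac)
  have "(\<lambda>n. v n * (qint q n * p (n - 1))) sums (\<Sum>n. w n * p n)"
    using sums_Suc[of "\<lambda>n. v n * (qint q n * p (n - 1))"] summable_sums[OF summ[OF w]]
    by (simp add: w_def mult_ac)
  then have 3: "(\<lambda>n. u n * (qint q n * (qint q (n - 1) * p (n - 2)))) sums (\<Sum>n. w n * p n)"
    using sums_Suc[of "\<lambda>n. u n * (qint q n * (qint q (n - 1) * p (n - 2)))"]
    by (simp add: v_def mult_ac numeral_2_eq_2)
  have "(\<lambda>n. u n * p n - (1 - q) * \<rho> * y * (u n * (qint q n * p (n - 1)))
          + (1 - q) * \<rho>\<^sup>2 * (u n * (qint q n * (qint q (n - 1) * p (n - 2))))) sums
        ((\<Sum>n. u n * p n) - (1 - q) * \<rho> * y * (\<Sum>n. v n * p n) + (1 - q) * \<rho>\<^sup>2 * (\<Sum>n. w n * p n))"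
    by (intro sums_add sums_diff sums_mult 1 2 3)
  moreover have "u n * p n - (1 - q) * \<rho> * y * (u n * (qint q n * p (n - 1)))
          + (1 - q) * \<rho>\<^sup>2 * (u n * (qint q n * (qint q (n - 1) * p (n - 2))))
        = u n * al_salam_chihara q \<rho> y n x" for n
    unfolding al_salam_chihara_connection[of q \<rho> y n x] p by (simp add: algebra_simps)
  ultimately have "recip_kernel q \<rho> y x =
      (\<Sum>n. u n * p n) - (1 - q) * \<rho> * y * (\<Sum>n. v n * p n) + (1 - q) * \<rho>\<^sup>2 * (\<Sum>n. w n * p n)"
    by (simp add: recip_kernel_def u_def sums_iff)
  moreover have "(\<lambda>n. u n * p n - (1 - q) * \<rho> * y * (v n * p n) + (1 - q) * \<rho>\<^sup>2 * (w n * p n)) sums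
        ((\<Sum>n. u n * p n) - (1 - q) * \<rho> * y * (\<Sum>n. v n * p n) + (1 - q) * \<rho>\<^sup>2 * (\<Sum>n. w n * p n))"
    by (intro sums_add sums_diff sums_mult summable_sums summ u v w)
  moreover have "u n * p n - (1 - q) * \<rho> * y * (v n * p n) + (1 - q) * \<rho>\<^sup>2 * (w n * p n)
      = (u n - (1 - q) * \<rho> * y * v n + (1 - q) * \<rho>\<^sup>2 * w n) * p n" for n
    by (simp add: algebra_simps)
  ultimately have "(\<lambda>n. (u n - (1 - q) * \<rho> * y * v n + (1 - q) * \<rho>\<^sup>2 * w n) * p n)
      sums recip_kernel q \<rho> y x"
    by (simp only:)
  then show ?thesis
    unfolding p v_def w_def .
qed

text \<open>The denominator in \<open>f_CN\<close> at index \<open>k\<close> is the value of this at \<open>q ^ k * \<rho>\<close>.\<close>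
definition kernel_factor :: "real \<Rightarrow> real \<Rightarrow> real \<Rightarrow> real \<Rightarrow> real" where
  "kernel_factor q \<rho> y x = (1 - \<rho>\<^sup>2)\<^sup>2 - (1 - q) * \<rho> * (1 + \<rho>\<^sup>2) * x * y + (1 - q) * \<rho>\<^sup>2 * (x\<^sup>2 + y\<^sup>2)"

lemma B_poly_Suc_Suc: "B_poly q (Suc (Suc n)) y + q ^ Suc n * y * B_poly q (Suc n) y = q ^ n * qint q (Suc n) * B_poly q n y"
  by simp

text \<open>Comparison of coefficients in the functional equation, with \<open>Q\<close> for
  \<open>q ^ n\<close>, \<open>N\<close> for \<open>qint q n\<close>, and \<open>b\<close>,
  \<open>b1\<close> for \<open>B_poly\<close> at \<open>n\<close> and \<open>n + 1\<close>; its
  value at \<open>n + 2\<close> is already eliminated by the recursion. Substituting for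
  \<open>Q\<close> leaves a polynomial identity.\<close>

lemma recip_kernel_coeff_identity:
  fixes b b1 g q Q N y r :: real
  assumes "(1 - q) * N = 1 - Q"
  shows "g * ((1 - r\<^sup>2 * Q) * (1 - r\<^sup>2 * (q * Q)) * b)
      - (1 - q) * r * y * (g * (r * (1 - r\<^sup>2 * (q * Q)) * b1))
      + (1 - q) * r\<^sup>2 * (g * (r\<^sup>2 * (Q * (N + Q) * b - q * Q * y * b1)))
    = ((1 - r\<^sup>2)\<^sup>2 + (1 - q) * r\<^sup>2 * y\<^sup>2) * (g * (Q * b))
      - (1 - q) * (1 + r\<^sup>2) * y * (g * (b1 + Q * y * b))
      + (1 - q) * (g * (y * (b1 + Q * y * b) + (N + r\<^sup>2 * Q) * b))"
proof -
  have Q: "Q = 1 - (1 - q) * N" using assms by simp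
  show ?thesis unfolding Q by algebra
qed

text \<open>As a polynomial in \<open>\<rho> * x\<close>, \<open>kernel_factor\<close> has constant
  term \<open>(1 - \<rho>^2)^2 + (1 - q) * \<rho>^2 * y^2\<close>, linear coefficient
  \<open>- (1 - q) * (1 + \<rho>^2) * y\<close> and leading coefficient \<open>1 - q\<close>. It
  therefore suffices to know how multiplication by \<open>\<rho> * x\<close>, applied once and
  twice, acts on the coefficients of the series at \<open>q * \<rho>\<close>.\<close>

lemma recip_kernel_functional_equation:
  assumes q: "\<bar>q\<bar> < 1" and \<rho>: "\<bar>\<rho>\<bar> < 1"
  shows "(1 - \<rho>\<^sup>2) * (1 - \<rho>\<^sup>2 * q) * recip_kernel q \<rho> y x =
         kernel_factor q \<rho> y x * recip_kernel q (q * \<rho>) y x"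
proof -
  define p where "p = (\<lambda>n. al_salam_chihara q (q * \<rho>) y n x)"
  have p: "al_salam_chihara q (q * \<rho>) y n x = p n" for n
    by (simp add: p_def)
  define B where "B = (\<lambda>n. B_poly q n y)"
  define S where "S = recip_kernel q (q * \<rho>) y x"
  \<comment> \<open>The power is that of \<rho>, not of \<open>q * \<rho>\<close>: multiplication by
    \<open>\<rho> * x\<close> removes the factor \<open>q ^ n\<close> of \<open>u\<close>, and
    \<open>q\<close> may be 0, so it cannot be divided out later.\<close>
  define g where "g = (\<lambda>n. \<rho> ^ n / (qpoch q ((q * \<rho>)\<^sup>2) n * qfact q n))"
  define u where "u = (\<lambda>n. q ^ n * g n * B n)"
  define E where "E = (\<lambda>n. B (Suc n) + q ^ n * y * B n)"
  define e where "e = (\<lambda>n. g n * E n)"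
  have q\<rho>: "\<bar>q * \<rho>\<bar> < 1"
    using q \<rho> by (metis abs_ge_zero abs_mult mult_strict_mono' mult_1)
  have sq: "\<rho>\<^sup>2 < 1" "(q * \<rho>)\<^sup>2 < 1"
    using \<rho> q\<rho> by (simp_all only: abs_square_less_1)
  have pos: "qpoch q ((q * \<rho>)\<^sup>2) n > 0" "qfact q n > 0" "qint q (Suc n) > 0" "qpoch q (\<rho>\<^sup>2) n > 0" for n
    using sq by (auto intro!: qpoch_pos qfact_pos qint_Suc_pos q)
  have E0: "E 0 = 0" by (simp add: E_def B_def)
  have ESuc: "E (Suc n) = q ^ n * qint q (Suc n) * B n" for n
    unfolding E_def B_def by (rule B_poly_Suc_Suc)
  have g0: "g 0 = 1" by (simp add: g_def)
  have gSuc: "g (Suc n) * ((1 - (q * \<rho>)\<^sup>2 * q ^ n) * qint q (Suc n)) = \<rho> * g n" for n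
    using pos(1)[of n] pos(1)[of "Suc n"] pos(2,3)[of n]
    by (auto simp: g_def qfact_Suc qpoch_Suc)
  have u_eq: "u = recip_kernel_coeff q (q * \<rho>) y"
    by (auto simp: u_def recip_kernel_coeff_def g_def B_def power_mult_distrib)
  have u: "superexp_small u"
    unfolding u_eq by (rule recip_kernel_coeff_superexp_small[OF q q\<rho>])
  have S: "(\<lambda>n. u n * p n) sums S"
    unfolding S_def recip_kernel_def u_eq p_def
    by (rule summable_sums[OF recip_kernel_coeff_summable[OF q q\<rho>]])

  \<comment> \<open>\<open>M\<close> is multiplication by \<open>x\<close> on coefficients; on \<open>u\<close> it collapses to a single term
    because of the recursion of \<open>B\<close>.\<close>
  define M where "M = (\<lambda>a n. (case n of 0 \<Rightarrow> 0 | Suc m \<Rightarrow> a m) + q * \<rho> * y * q ^ n * a n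
             + (1 - (q * \<rho>)\<^sup>2 * q ^ n) * qint q (Suc n) * a (Suc n))"
  have Mu: "\<rho> * M u n = e n" for n
  proof -
    have "(1 - (q * \<rho>)\<^sup>2 * q ^ n) * qint q (Suc n) * u (Suc n)
        = q ^ Suc n * B (Suc n) * (g (Suc n) * ((1 - (q * \<rho>)\<^sup>2 * q ^ n) * qint q (Suc n)))"
      by (simp add: u_def)
    also have "\<dots> = q ^ Suc n * B (Suc n) * (\<rho> * g n)"
      by (simp only: gSuc)
    finally have third: "(1 - (q * \<rho>)\<^sup>2 * q ^ n) * qint q (Suc n) * u (Suc n)
        = q ^ Suc n * B (Suc n) * (\<rho> * g n)" .
    have "u n = q ^ n * g n * B n" by (simp add: u_def)
    then have *: "M u n = (case n of 0 \<Rightarrow> 0 | Suc m \<Rightarrow> u m) + q * \<rho> * q ^ n * g n * E n"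
      unfolding M_def third by (simp add: E_def algebra_simps)
    show ?thesis
    proof (cases n)
      case 0
      then show ?thesis unfolding * by (simp add: e_def E0)
    next
      case (Suc m)
      have "\<rho> * u m = q ^ m * B m * (\<rho> * g m)" by (simp add: u_def)
      also have "\<dots> = g n * (1 - (q * \<rho>)\<^sup>2 * q ^ m) * E n"
        by (simp add: gSuc[symmetric] Suc ESuc)
      finally show ?thesis
        unfolding * by (simp add: Suc e_def algebra_simps power2_eq_square)
    qed
  qed
  have e: "superexp_small e"
  proof -
    \<comment> \<open>The factorial in \<open>g n\<close> stops at \<open>n\<close> while
      \<open>E n\<close> contains \<open>B (Suc n)\<close>; the missing factor
      \<open>qint q (Suc n)\<close> is bounded. The rest of \<open>e\<close> is
      \<open>y * u n\<close>.\<close>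
    define b where "b = (\<lambda>n. B n / qfact q n)"
    have b: "superexp_small b"
      unfolding b_def B_def by (rule B_poly_div_qfact_superexp_small[OF q])
    have "superexp_small (\<lambda>n. \<rho> ^ n / qpoch q ((q * \<rho>)\<^sup>2) n * (qint q (Suc n) * b (Suc n)))"
    proof (rule superexp_small_mult[OF superexp_small_qint_Suc[OF q b]])
      show "0 < 1 / (1 - \<rho>\<^sup>2)" using sq by simp
      have "\<bar>\<rho>\<bar> ^ n * (1 / (1 - \<rho>\<^sup>2)) ^ n \<le> 1 * (1 / (1 - \<rho>\<^sup>2)) ^ n" for n
        using \<rho> sq by (intro mult_right_mono) (auto simp: power_le_one)
      moreover have "\<bar>q * \<rho>\<bar> \<le> \<bar>\<rho>\<bar>"
        using q by (simp add: abs_mult mult_left_le_one_le)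
      ultimately show "\<bar>\<rho> ^ n / qpoch q ((q * \<rho>)\<^sup>2) n\<bar> \<le> 1 * (1 / (1 - \<rho>\<^sup>2)) ^ n" for n
        using power_div_qpoch_bound[OF q _ \<rho>, of "q * \<rho>" \<rho> n] by (meson order_trans)
    qed
    moreover have "superexp_small (\<lambda>n. y * u n)"
      by (rule superexp_small_mult[OF u, of 1 _ "\<bar>y\<bar>"]) auto
    ultimately have "superexp_small (\<lambda>n. \<rho> ^ n / qpoch q ((q * \<rho>)\<^sup>2) n * (qint q (Suc n) * b (Suc n)) + y * u n)"
      by (rule superexp_small_add)
    moreover have "\<rho> ^ n / qpoch q ((q * \<rho>)\<^sup>2) n * (qint q (Suc n) * b (Suc n)) + y * u n = e n" for n
    proof -
      have "qint q (Suc n) * b (Suc n) = B (Suc n) / qfact q n"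
        using pos(3)[of n] by (simp add: b_def qfact_Suc)
      then show ?thesis
        by (simp add: e_def E_def g_def u_def algebra_simps add_divide_distrib)
    qed
    ultimately show ?thesis by simp
  qed
  have Me: "\<rho> * M e n = g n * (y * E n + (qint q n + \<rho>\<^sup>2 * q ^ n) * B n)" for n
  proof -
    have "(1 - (q * \<rho>)\<^sup>2 * q ^ n) * qint q (Suc n) * e (Suc n)
        = E (Suc n) * (g (Suc n) * ((1 - (q * \<rho>)\<^sup>2 * q ^ n) * qint q (Suc n)))"
      by (simp add: e_def)
    also have "\<dots> = \<rho> * g n * (q ^ n * qint q (Suc n) * B n)"
      unfolding gSuc ESuc by (simp only: mult_ac)
    finally have *: "M e n = (case n of 0 \<Rightarrow> 0 | Suc m \<Rightarrow> e m) + q * \<rho> * y * q ^ n * (g n * E n)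
        + \<rho> * g n * (q ^ n * qint q (Suc n) * B n)"
      by (simp only: M_def e_def)
    show ?thesis
    proof (cases n)
      case 0
      then show ?thesis
        unfolding * by (simp add: E0 power2_eq_square qint_Suc algebra_simps)
    next
      case (Suc m)
      have "\<rho> * e m = E m * (\<rho> * g m)" by (simp add: e_def)
      also have "\<dots> = g n * (1 - (q * \<rho>)\<^sup>2 * q ^ m) * (qint q n * E m)"
        by (simp add: gSuc[symmetric] Suc)
      \<comment> \<open>Here \<open>n = Suc m\<close>, and the second summand of \<open>E m\<close>,
        multiplied by \<open>qint q n\<close>, is \<open>y * E n\<close> by the recursion of
        \<open>B\<close>.\<close>
      also have "qint q n * E m = qint q n * B n + y * E n"
        by (simp only: Suc ESuc distrib_left) (simp add: E_def algebra_simps)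
      finally have "\<rho> * e m = g n * (1 - (q * \<rho>)\<^sup>2 * q ^ m) * (qint q n * B n + y * E n)" .
      then have "\<rho> * M e n = g n * (1 - (q * \<rho>)\<^sup>2 * q ^ m) * (qint q n * B n + y * E n)
         + \<rho> * (q * \<rho> * y * q ^ n * (g n * E n) + \<rho> * g n * (q ^ n * (qint q n + q ^ n) * B n))"
        unfolding * by (simp add: Suc qint_Suc distrib_left)
      \<comment> \<open>The two terms with \<open>q * \<rho>^2 * q ^ n * y * E n\<close> cancel, and
        the bracket \<open>(1 - q) * qint q n + q ^ n\<close> that remains equals 1.\<close>
      also have "\<dots> = g n * (y * E n + qint q n * B n
          + \<rho>\<^sup>2 * q ^ n * ((1 - q) * qint q n + q ^ n) * B n)"
        by (simp add: Suc algebra_simps power2_eq_square)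
      also have "\<dots> = g n * (y * E n + (qint q n + \<rho>\<^sup>2 * q ^ n) * B n)"
        unfolding one_minus_mult_qint by (simp add: algebra_simps)
      finally show ?thesis .
    qed
  qed
  have xu: "(\<lambda>n. \<rho> * (M u n * p n)) sums (\<rho> * (x * S))"
    using al_salam_chihara_expansion_mult_sums[OF q q\<rho> u, of y x] S
    unfolding p by (intro sums_mult) (simp add: M_def sums_iff)
  then have "(\<Sum>n. e n * p n) = \<rho> * (x * S)"
    by (simp add: sums_iff flip: Mu mult.assoc)
  then have xe: "(\<lambda>n. \<rho> * (M e n * p n)) sums (\<rho> * (x * (\<rho> * (x * S))))"
    using al_salam_chihara_expansion_mult_sums[OF q q\<rho> e, of y x]
    unfolding p by (intro sums_mult) (simp add: M_def)
  have rhs: "(\<lambda>n. ((1 - \<rho>\<^sup>2)\<^sup>2 + (1 - q) * \<rho>\<^sup>2 * y\<^sup>2) * (u n * p n)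
       - (1 - q) * (1 + \<rho>\<^sup>2) * y * (\<rho> * (M u n * p n)) + (1 - q) * (\<rho> * (M e n * p n)))
     sums (((1 - \<rho>\<^sup>2)\<^sup>2 + (1 - q) * \<rho>\<^sup>2 * y\<^sup>2) * S
       - (1 - q) * (1 + \<rho>\<^sup>2) * y * (\<rho> * (x * S)) + (1 - q) * (\<rho> * (x * (\<rho> * (x * S)))))"
    by (intro sums_add sums_diff sums_mult S xu xe)
  define A where "A = (1 - \<rho>\<^sup>2) * (1 - \<rho>\<^sup>2 * q)"
  define U where "U = recip_kernel_coeff q \<rho> y"
  have lhs: "(\<lambda>n. A * ((U n - (1 - q) * \<rho> * y * (qint q (Suc n) * U (Suc n))
           + (1 - q) * \<rho>\<^sup>2 * (qint q (Suc n) * (qint q (Suc (Suc n)) * U (Suc (Suc n))))) * p n))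
        sums (A * recip_kernel q \<rho> y x)"
    using recip_kernel_sums_shifted[OF q \<rho>, of y x] unfolding p U_def by (rule sums_mult)
  \<comment> \<open>Both sides expand in the polynomials for \<open>q * \<rho>\<close>, and the coefficients agree one by one.\<close>
  have coeff: "A * (U n - (1 - q) * \<rho> * y * (qint q (Suc n) * U (Suc n))
           + (1 - q) * \<rho>\<^sup>2 * (qint q (Suc n) * (qint q (Suc (Suc n)) * U (Suc (Suc n)))))
      = ((1 - \<rho>\<^sup>2)\<^sup>2 + (1 - q) * \<rho>\<^sup>2 * y\<^sup>2) * u n
       - (1 - q) * (1 + \<rho>\<^sup>2) * y * (\<rho> * M u n) + (1 - q) * (\<rho> * M e n)" for n
  proof -
    define Q where "Q = q ^ n"
    define b where "b = B n"
    define b1 where "b1 = B (Suc n)"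
    have b2: "B (Suc (Suc n)) = Q * (qint q n + Q) * b - q * Q * y * b1"
      by (simp add: B_def Q_def b_def b1_def qint_Suc)
    \<comment> \<open>Replacing \<rho> by \<open>q * \<rho>\<close> shifts the Pochhammer symbol of
      \<rho>^2 by two places; \<open>A\<close> consists of the two factors lost.\<close>
    have "A * qpoch q ((q * \<rho>)\<^sup>2) n = qpoch q (\<rho>\<^sup>2) (Suc (Suc n))"
      by (simp add: A_def qpoch_Suc_shift power2_eq_square mult_ac)
    then have Aq: "A * qpoch q ((q * \<rho>)\<^sup>2) n = qpoch q (\<rho>\<^sup>2) n * (1 - \<rho>\<^sup>2 * Q) * (1 - \<rho>\<^sup>2 * (q * Q))"
      by (simp add: qpoch_Suc Q_def)
    have nz: "qpoch q ((q * \<rho>)\<^sup>2) n \<noteq> 0" "qpoch q (\<rho>\<^sup>2) n \<noteq> 0" "qfact q n \<noteq> 0"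
        "qint q (Suc n) \<noteq> 0" "qint q (Suc (Suc n)) \<noteq> 0" "1 - \<rho>\<^sup>2 * Q \<noteq> 0" "1 - \<rho>\<^sup>2 * (q * Q) \<noteq> 0"
      using pos(1-3)[of n] pos(4)[of n] pos(4)[of "Suc n"] pos(4)[of "Suc (Suc n)"] pos(3)[of "Suc n"]
      by (auto simp: qpoch_Suc Q_def)
    have A: "A = qpoch q (\<rho>\<^sup>2) n * (1 - \<rho>\<^sup>2 * Q) * (1 - \<rho>\<^sup>2 * (q * Q)) / qpoch q ((q * \<rho>)\<^sup>2) n"
      using Aq nz by (simp add: field_simps)
    have U0: "A * U n = g n * ((1 - \<rho>\<^sup>2 * Q) * (1 - \<rho>\<^sup>2 * (q * Q)) * b)"
      using nz by (simp add: A U_def recip_kernel_coeff_def g_def b_def B_def)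
    have U1: "A * (qint q (Suc n) * U (Suc n)) = g n * (\<rho> * (1 - \<rho>\<^sup>2 * (q * Q)) * b1)"
      using nz by (simp add: A U_def recip_kernel_coeff_def g_def b1_def B_def qpoch_Suc qfact_Suc Q_def[symmetric])
    have U2: "A * (qint q (Suc n) * (qint q (Suc (Suc n)) * U (Suc (Suc n))))
        = g n * (\<rho>\<^sup>2 * (Q * (qint q n + Q) * b - q * Q * y * b1))"
      using nz unfolding b2[symmetric]
      by (simp add: A U_def recip_kernel_coeff_def g_def B_def qpoch_Suc qfact_Suc Q_def[symmetric] power2_eq_square
            del: B_poly.simps)
    have "A * (U n - (1 - q) * \<rho> * y * (qint q (Suc n) * U (Suc n))
           + (1 - q) * \<rho>\<^sup>2 * (qint q (Suc n) * (qint q (Suc (Suc n)) * U (Suc (Suc n)))))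
      = A * U n - (1 - q) * \<rho> * y * (A * (qint q (Suc n) * U (Suc n)))
           + (1 - q) * \<rho>\<^sup>2 * (A * (qint q (Suc n) * (qint q (Suc (Suc n)) * U (Suc (Suc n)))))"
      by (simp add: algebra_simps)
    also have "\<dots> = ((1 - \<rho>\<^sup>2)\<^sup>2 + (1 - q) * \<rho>\<^sup>2 * y\<^sup>2) * u n
       - (1 - q) * (1 + \<rho>\<^sup>2) * y * (\<rho> * M u n) + (1 - q) * (\<rho> * M e n)"
    proof -
      have N: "(1 - q) * qint q n = 1 - Q"
        unfolding one_minus_mult_qint Q_def ..
      have vals: "u n = g n * (Q * b)" "e n = g n * (b1 + Q * y * b)" "E n = b1 + Q * y * b" "B n = b"
        by (simp_all add: u_def e_def E_def Q_def b_def b1_def)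
      show ?thesis
        unfolding U0 U1 U2 Mu Me Q_def[symmetric] vals by (rule recip_kernel_coeff_identity[OF N])
    qed
    finally show ?thesis .
  qed
  have "A * recip_kernel q \<rho> y x = ((1 - \<rho>\<^sup>2)\<^sup>2 + (1 - q) * \<rho>\<^sup>2 * y\<^sup>2) * S
       - (1 - q) * (1 + \<rho>\<^sup>2) * y * (\<rho> * (x * S)) + (1 - q) * (\<rho> * (x * (\<rho> * (x * S))))"
  proof (rule sums_unique2[OF lhs])
    have "A * ((U n - (1 - q) * \<rho> * y * (qint q (Suc n) * U (Suc n))
           + (1 - q) * \<rho>\<^sup>2 * (qint q (Suc n) * (qint q (Suc (Suc n)) * U (Suc (Suc n))))) * p n)
      = ((1 - \<rho>\<^sup>2)\<^sup>2 + (1 - q) * \<rho>\<^sup>2 * y\<^sup>2) * (u n * p n)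
       - (1 - q) * (1 + \<rho>\<^sup>2) * y * (\<rho> * (M u n * p n)) + (1 - q) * (\<rho> * (M e n * p n))" for n
      unfolding mult.assoc[symmetric, of A] coeff by (simp add: algebra_simps)
    with rhs show "(\<lambda>n. A * ((U n - (1 - q) * \<rho> * y * (qint q (Suc n) * U (Suc n))
           + (1 - q) * \<rho>\<^sup>2 * (qint q (Suc n) * (qint q (Suc (Suc n)) * U (Suc (Suc n))))) * p n)) sums
      (((1 - \<rho>\<^sup>2)\<^sup>2 + (1 - q) * \<rho>\<^sup>2 * y\<^sup>2) * S
       - (1 - q) * (1 + \<rho>\<^sup>2) * y * (\<rho> * (x * S)) + (1 - q) * (\<rho> * (x * (\<rho> * (x * S)))))"
      by (simp only:)
  qed
  then show ?thesis
    by (simp add: A_def S_def kernel_factor_def power2_eq_square algebra_simps)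
qed

section \<open>Iteration of the functional equation\<close>

text \<open>The term of index 0 is 1. Every later term contains a positive power of the parameter,
  of size at most \<open>\<bar>q\<bar> ^ N\<close>, times a summable majorant that is independent of
  \<open>N\<close>.\<close>

lemma recip_kernel_tendsto_1:
  assumes q: "\<bar>q\<bar> < 1" and \<rho>: "\<bar>\<rho>\<bar> < 1"
  shows "(\<lambda>N. recip_kernel q (q ^ N * \<rho>) y x) \<longlonglongrightarrow> 1"
proof -
  obtain K where K: "K > 0" "\<And>\<sigma> n. \<bar>\<sigma>\<bar> < 1 \<Longrightarrow> \<bar>al_salam_chihara q \<sigma> y n x\<bar> \<le> K ^ n"
    using al_salam_chihara_bound[OF q, of y x] by metis
  define L where "L = 1 / (1 - \<rho>\<^sup>2)"
  have L: "L > 0" using \<rho> by (simp add: L_def abs_square_less_1)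
  define b where "b = (\<lambda>n. \<bar>B_poly q n y / qfact q n\<bar>)"
  have "superexp_small b"
    using B_poly_div_qfact_superexp_small[OF q, of y] by (simp add: superexp_small_def b_def)
  then have b: "summable (\<lambda>n. b n * (L * K) ^ n)"
    by (rule superexp_small_summable[of _ "L * K" _ 1]) (use L K in auto)
  have bound: "\<bar>recip_kernel q (q ^ N * \<rho>) y x - 1\<bar> \<le> \<bar>q\<bar> ^ N * (\<Sum>n. b (Suc n) * (L * K) ^ Suc n)" for N
  proof -
    define \<sigma> where "\<sigma> = q ^ N * \<rho>"
    have \<sigma>: "\<bar>\<sigma>\<bar> \<le> \<bar>\<rho>\<bar>" "\<bar>\<sigma>\<bar> \<le> \<bar>q\<bar> ^ N"
      using q \<rho> by (simp_all add: \<sigma>_def abs_mult power_abs mult_left_le mult_left_le_one_le power_le_one)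
    then have \<sigma>1: "\<bar>\<sigma>\<bar> < 1" using \<rho> by linarith
    define t where "t = (\<lambda>n. recip_kernel_coeff q \<sigma> y n * al_salam_chihara q \<sigma> y n x)"
    have t: "summable t" unfolding t_def by (rule recip_kernel_coeff_summable[OF q \<sigma>1])
    have tn: "\<bar>t n\<bar> \<le> \<bar>\<sigma>\<bar> ^ n * (b n * (L * K) ^ n)" for n
    proof -
      have "\<bar>t n\<bar> = \<bar>\<sigma> ^ n / qpoch q (\<sigma>\<^sup>2) n\<bar> * b n * \<bar>al_salam_chihara q \<sigma> y n x\<bar>"
        by (simp add: t_def recip_kernel_coeff_def b_def abs_mult)
      also have "\<dots> \<le> (\<bar>\<sigma>\<bar> ^ n * L ^ n) * b n * K ^ n"
        unfolding L_def using K(2)[OF \<sigma>1] \<rho> \<sigma>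
        by (intro mult_mono power_div_qpoch_bound q) (auto simp: b_def abs_square_less_1 less_imp_le)
      finally show ?thesis by (simp add: power_mult_distrib mult_ac)
    qed
    have "t 0 = 1" by (simp add: t_def recip_kernel_coeff_def)
    then have "recip_kernel q \<sigma> y x - 1 = (\<Sum>n. t (Suc n))"
      using suminf_split_head[OF t] by (simp add: recip_kernel_def t_def)
    also have "\<bar>\<dots>\<bar> \<le> (\<Sum>n. \<bar>q\<bar> ^ N * (b (Suc n) * (L * K) ^ Suc n))"
    proof (rule norm_suminf_le[where 'a = real, unfolded real_norm_def])
      show "summable (\<lambda>n. \<bar>q\<bar> ^ N * (b (Suc n) * (L * K) ^ Suc n))"
        using summable_ignore_initial_segment[OF b, of 1] by (intro summable_mult) simp
      show "\<bar>t (Suc n)\<bar> \<le> \<bar>q\<bar> ^ N * (b (Suc n) * (L * K) ^ Suc n)" for n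
      proof -
        have "\<bar>\<sigma>\<bar> ^ Suc n \<le> \<bar>\<sigma>\<bar>"
          using \<sigma>1 by (simp add: mult_left_le power_le_one)
        also note \<sigma>(2)
        finally show ?thesis
          using L K by (intro order_trans[OF tn] mult_right_mono) (auto simp: b_def)
      qed
    qed
    also have "\<dots> = \<bar>q\<bar> ^ N * (\<Sum>n. b (Suc n) * (L * K) ^ Suc n)"
      using summable_ignore_initial_segment[OF b, of 1] by (intro suminf_mult) simp
    finally show ?thesis by (simp add: \<sigma>_def)
  qed
  have "(\<lambda>N. \<bar>q\<bar> ^ N * (\<Sum>n. b (Suc n) * (L * K) ^ Suc n)) \<longlonglongrightarrow> 0"
    using tendsto_mult_left_zero[OF LIMSEQ_realpow_zero[of "\<bar>q\<bar>"]] q by auto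
  then have "(\<lambda>N. recip_kernel q (q ^ N * \<rho>) y x - 1) \<longlonglongrightarrow> 0"
    by (rule Lim_null_comparison[rotated]) (use bound in auto)
  then show ?thesis
    by (simp add: LIM_zero_iff)
qed

text \<open>Each use of the functional equation contributes two Pochhammer factors and one
  denominator factor, hence \<open>2 * N\<close> against \<open>N\<close>.\<close>

lemma qpoch_mult_recip_kernel:
  assumes q: "\<bar>q\<bar> < 1" and \<rho>: "\<bar>\<rho>\<bar> < 1"
  shows "qpoch q (\<rho>\<^sup>2) (2 * N) * recip_kernel q \<rho> y x =
         (\<Prod>k<N. kernel_factor q (q ^ k * \<rho>) y x) * recip_kernel q (q ^ N * \<rho>) y x"
proof (induction N)
  case (Suc N)
  have N: "\<bar>q ^ N * \<rho>\<bar> < 1"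
    using abs_mult_power_le[OF q, of \<rho> N] \<rho> by (simp add: mult.commute)
  have "qpoch q (\<rho>\<^sup>2) (2 * Suc N) * recip_kernel q \<rho> y x
      = (1 - (q ^ N * \<rho>)\<^sup>2) * (1 - (q ^ N * \<rho>)\<^sup>2 * q) * (qpoch q (\<rho>\<^sup>2) (2 * N) * recip_kernel q \<rho> y x)"
    by (simp add: qpoch_Suc power_mult_distrib mult_ac flip: power_mult)
  also have "\<dots> = (\<Prod>k<N. kernel_factor q (q ^ k * \<rho>) y x) *
      ((1 - (q ^ N * \<rho>)\<^sup>2) * (1 - (q ^ N * \<rho>)\<^sup>2 * q) * recip_kernel q (q ^ N * \<rho>) y x)"
    unfolding Suc.IH by (simp only: mult_ac)
  also have "\<dots> = (\<Prod>k<N. kernel_factor q (q ^ k * \<rho>) y x) * (kernel_factor q (q ^ N * \<rho>) y x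
      * recip_kernel q (q * (q ^ N * \<rho>)) y x)"
    by (simp only: recip_kernel_functional_equation[OF q N])
  finally show ?case by (simp add: mult_ac)
qed simp

section \<open>Positivity and convergence of the infinite products\<close>

text \<open>Completing the square in \<open>\<rho> * x\<close> leaves
  \<open>(1 - \<rho>^2)^2 * (1 - (1 - q) * y^2 / 4)\<close>, which is positive by the bound on
  \<open>y\<close>.\<close>

lemma kernel_factor_pos:
  assumes q: "\<bar>q\<bar> < 1" and \<rho>: "\<bar>\<rho>\<bar> < 1" and y: "(1 - q) * y\<^sup>2 < 4"
  shows "kernel_factor q \<rho> y x > 0"
proof -
  have "kernel_factor q \<rho> y x =
      (1 - q) * (\<rho> * x - (1 + \<rho>\<^sup>2) * y / 2)\<^sup>2 + (1 - \<rho>\<^sup>2)\<^sup>2 * (1 - (1 - q) * y\<^sup>2 / 4)"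
    by (simp add: kernel_factor_def power2_eq_square field_simps)
  moreover have "\<rho>\<^sup>2 < 1" using \<rho> by (simp add: abs_square_less_1)
  ultimately show ?thesis
    using q y by (auto intro!: add_nonneg_pos mult_pos_pos)
qed

lemma convergent_prod_geometric:
  fixes f :: "nat \<Rightarrow> real"
  assumes q: "\<bar>q\<bar> < 1" and le: "\<And>k. \<bar>f k - 1\<bar> \<le> C * \<bar>q\<bar> ^ k"
  shows "convergent_prod f"
proof -
  have "summable (\<lambda>k. norm (f k - 1))"
    by (rule summable_comparison_test'[where g = "\<lambda>k. C * \<bar>q\<bar> ^ k" and N = 0])
       (use assms in \<open>auto intro!: summable_mult summable_geometric\<close>)
  then show ?thesis
    by (intro abs_convergent_prod_imp_convergent_prod summable_imp_abs_convergent_prod)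
qed

lemma convergent_prod_LIMSEQ_lessThan:
  fixes f :: "nat \<Rightarrow> real"
  assumes "convergent_prod f"
  shows "(\<lambda>n. \<Prod>k<n. f k) \<longlonglongrightarrow> prodinf f"
  using convergent_prod_LIMSEQ[OF assms] LIMSEQ_lessThan_iff_atMost[of "\<lambda>A. prod f A"] by auto

lemma convergent_prod_kernel_factor:
  assumes q: "\<bar>q\<bar> < 1"
  shows "convergent_prod (\<lambda>k. kernel_factor q (q ^ k * \<rho>) y x)"
proof (rule convergent_prod_geometric[OF q])
  fix k
  define s where "s = q ^ k * \<rho>"
  define R where "R = \<bar>\<rho>\<bar>"
  have s: "\<bar>s\<bar> \<le> \<bar>q\<bar> ^ k * R" "\<bar>s\<bar> \<le> R"
    using q by (simp_all add: s_def R_def abs_mult power_abs mult_left_le_one_le power_le_one)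
  \<comment> \<open>All terms of \<open>kernel_factor\<close> other than 1 are divisible by
    \<open>s\<close>, which carries the geometric decay; the cofactor is bounded by means of
    \<open>\<bar>s\<bar> \<le> R\<close> and \<open>1 - q \<le> 2\<close>.\<close>
  have "\<bar>kernel_factor q s y x - 1\<bar> =
      \<bar>s\<bar> * \<bar>- 2 * s + s * s\<^sup>2 - (1 - q) * (1 + s\<^sup>2) * x * y + (1 - q) * s * (x\<^sup>2 + y\<^sup>2)\<bar>"
    by (subst abs_mult[symmetric]) (simp add: kernel_factor_def power2_eq_square algebra_simps)
  also have "\<dots> \<le> (\<bar>q\<bar> ^ k * R) * (2 * R + R * R\<^sup>2 + 2 * (1 + R\<^sup>2) * \<bar>x * y\<bar> + 2 * R * (x\<^sup>2 + y\<^sup>2))"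
  proof (intro mult_mono s)
    have s2: "s\<^sup>2 \<le> R\<^sup>2" using s(2) by (metis abs_ge_zero power2_abs power_mono)
    have "\<bar>s * s\<^sup>2\<bar> \<le> R * R\<^sup>2" unfolding abs_mult using s(2) s2 by (intro mult_mono) (auto simp: R_def)
    moreover have "\<bar>(1 - q) * (1 + s\<^sup>2) * (x * y)\<bar> \<le> 2 * (1 + R\<^sup>2) * \<bar>x * y\<bar>"
      unfolding abs_mult[of _ "x * y"] abs_mult[of "1 - q"] using q s2 by (intro mult_mono) auto
    moreover have "\<bar>(1 - q) * s * (x\<^sup>2 + y\<^sup>2)\<bar> \<le> 2 * R * (x\<^sup>2 + y\<^sup>2)"
      unfolding abs_mult using q s(2) by (intro mult_mono) (auto simp: R_def)
    ultimately show "\<bar>- 2 * s + s * s\<^sup>2 - (1 - q) * (1 + s\<^sup>2) * x * y + (1 - q) * s * (x\<^sup>2 + y\<^sup>2)\<bar>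
        \<le> 2 * R + R * R\<^sup>2 + 2 * (1 + R\<^sup>2) * \<bar>x * y\<bar> + 2 * R * (x\<^sup>2 + y\<^sup>2)"
      using s(2) unfolding mult.assoc[of _ x y] by linarith
  qed (auto simp: R_def)
  finally show "\<bar>kernel_factor q (q ^ k * \<rho>) y x - 1\<bar>
    \<le> (R * (2 * R + R * R\<^sup>2 + 2 * (1 + R\<^sup>2) * \<bar>x * y\<bar> + 2 * R * (x\<^sup>2 + y\<^sup>2))) * \<bar>q\<bar> ^ k"
    by (simp add: s_def mult_ac)
qed

lemma convergent_prod_qpoch:
  fixes a q :: real
  assumes q: "\<bar>q\<bar> < 1"
  shows "convergent_prod (\<lambda>k. 1 - a * q ^ k)"
  by (rule convergent_prod_geometric[OF q, of _ "\<bar>a\<bar>"]) (simp add: abs_mult power_abs)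

text \<open>The limit of the iterated equation as \<open>N\<close> tends to infinity, with the
  Pochhammer symbol taken along even indices.\<close>

lemma qpoch_inf_mult_recip_kernel:
  assumes q: "\<bar>q\<bar> < 1" and \<rho>: "\<bar>\<rho>\<bar> < 1"
  shows "qpoch_inf q (\<rho>\<^sup>2) * recip_kernel q \<rho> y x = (\<Prod>k. kernel_factor q (q ^ k * \<rho>) y x)"
proof (rule LIMSEQ_unique)
  have "(\<lambda>n. qpoch q (\<rho>\<^sup>2) n) \<longlonglongrightarrow> qpoch_inf q (\<rho>\<^sup>2)"
    unfolding qpoch_def qpoch_inf_def
    by (intro convergent_prod_LIMSEQ_lessThan convergent_prod_qpoch q)
  then have "(\<lambda>N. qpoch q (\<rho>\<^sup>2) (2 * N)) \<longlonglongrightarrow> qpoch_inf q (\<rho>\<^sup>2)"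
    by (rule filterlim_compose) (intro filterlim_subseq strict_monoI; simp)
  then show "(\<lambda>N. qpoch q (\<rho>\<^sup>2) (2 * N) * recip_kernel q \<rho> y x) \<longlonglongrightarrow> qpoch_inf q (\<rho>\<^sup>2) * recip_kernel q \<rho> y x"
    by (intro tendsto_mult tendsto_const)
  have "(\<lambda>N. (\<Prod>k<N. kernel_factor q (q ^ k * \<rho>) y x) * recip_kernel q (q ^ N * \<rho>) y x)
      \<longlonglongrightarrow> (\<Prod>k. kernel_factor q (q ^ k * \<rho>) y x) * 1"
    by (intro tendsto_mult convergent_prod_LIMSEQ_lessThan convergent_prod_kernel_factor
        recip_kernel_tendsto_1 q \<rho>)
  then show "(\<lambda>N. qpoch q (\<rho>\<^sup>2) (2 * N) * recip_kernel q \<rho> y x) \<longlonglongrightarrow> (\<Prod>k. kernel_factor q (q ^ k * \<rho>) y x)"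
    by (simp add: qpoch_mult_recip_kernel[OF q \<rho>])
qed

section \<open>Comparison of the two densities\<close>

theorem mainTheorem3:
  fixes q \<rho> x y :: real
  assumes "\<bar>q\<bar> < 1" and "\<bar>\<rho>\<bar> < 1"
    and "\<bar>x\<bar> < 2 / sqrt (1 - q)" and "\<bar>y\<bar> < 2 / sqrt (1 - q)"
  shows "summable (\<lambda>n. \<rho> ^ n / (qpoch q (\<rho>\<^sup>2) n * qfact q n)
                         * B_poly q n y * al_salam_chihara q \<rho> y n x) \<and>
         f_N q x = f_CN q \<rho> y x *
           (\<Sum>n. \<rho> ^ n / (qpoch q (\<rho>\<^sup>2) n * qfact q n)
                         * B_poly q n y * al_salam_chihara q \<rho> y n x)"
proof
  note q = assms(1) and \<rho> = assms(2)
  show "summable (\<lambda>n. \<rho> ^ n / (qpoch q (\<rho>\<^sup>2) n * qfact q n)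
                         * B_poly q n y * al_salam_chihara q \<rho> y n x)"
    using recip_kernel_coeff_summable[OF q \<rho>] by (simp add: recip_kernel_coeff_def)
  have "\<bar>y\<bar> * sqrt (1 - q) < 2"
    using assms(4) q by (simp add: field_simps)
  then have "(\<bar>y\<bar> * sqrt (1 - q))\<^sup>2 < 2\<^sup>2"
    using q by (intro power_strict_mono) auto
  then have y: "(1 - q) * y\<^sup>2 < 4"
    using q by (simp add: power_mult_distrib mult.commute)
  define D where "D = (\<lambda>k. kernel_factor q (q ^ k * \<rho>) y x)"
  have D: "convergent_prod D"
    unfolding D_def by (rule convergent_prod_kernel_factor[OF q])
  have "D k > 0" for k
    using abs_mult_power_le[OF q, of \<rho> k] \<rho> unfolding D_def
    by (intro kernel_factor_pos q y) (simp add: mult.commute)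
  \<comment> \<open>A product convergent in the sense of \<open>convergent_prod\<close> has a
    nonzero value once no factor vanishes, so the product in \<open>f_CN\<close> can be split as a
    quotient and the denominator cancelled.\<close>
  then have D0: "prodinf D \<noteq> 0"
    using D by (intro prodinf_nonzero) (auto simp: less_imp_neq[symmetric])
  have D_eq: "(1 - \<rho>\<^sup>2 * q ^ (2 * k))\<^sup>2 - (1 - q) * \<rho> * q ^ k * (1 + \<rho>\<^sup>2 * q ^ (2 * k)) * x * y
            + (1 - q) * \<rho>\<^sup>2 * (x\<^sup>2 + y\<^sup>2) * q ^ (2 * k) = D k" for k
    by (simp add: D_def kernel_factor_def power_mult_distrib mult_ac flip: power_mult)
  define F where "F = (\<lambda>k. (1 + q ^ k)\<^sup>2 - (1 - q) * x\<^sup>2 * q ^ k)"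
  have F: "convergent_prod F"
  proof (rule convergent_prod_geometric[OF q])
    fix k
    have "F k - 1 = q ^ k * (2 + q ^ k - (1 - q) * x\<^sup>2)"
      by (simp add: F_def power2_eq_square algebra_simps)
    moreover have "\<bar>2 + q ^ k - (1 - q) * x\<^sup>2\<bar> \<le> 3 + \<bar>(1 - q) * x\<^sup>2\<bar>"
      using power_abs_less_one(1)[OF q, of k] by linarith
    ultimately show "\<bar>F k - 1\<bar> \<le> (3 + \<bar>(1 - q) * x\<^sup>2\<bar>) * \<bar>q\<bar> ^ k"
      by (simp add: abs_mult power_abs mult.commute mult_left_mono)
  qed
  have "(\<Sum>n. \<rho> ^ n / (qpoch q (\<rho>\<^sup>2) n * qfact q n) * B_poly q n y * al_salam_chihara q \<rho> y n x)
      = recip_kernel q \<rho> y x"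
    by (simp add: recip_kernel_def recip_kernel_coeff_def)
  moreover have "qpoch_inf q (\<rho>\<^sup>2) * recip_kernel q \<rho> y x = prodinf D"
    unfolding D_def by (rule qpoch_inf_mult_recip_kernel[OF q \<rho>])
  moreover have "f_CN q \<rho> y x = sqrt (1 - q) * qpoch_inf q (\<rho>\<^sup>2) * qpoch_inf q q
      / (2 * pi * sqrt (4 - (1 - q) * x\<^sup>2)) * (prodinf F / prodinf D)"
    unfolding f_CN_def D_eq prodinf_divide[OF F D] by (simp add: F_def)
  moreover have "f_N q x = sqrt (1 - q) * qpoch_inf q q / (2 * pi * sqrt (4 - (1 - q) * x\<^sup>2)) * prodinf F"
    unfolding f_N_def F_def ..
  ultimately show "f_N q x = f_CN q \<rho> y x *
      (\<Sum>n. \<rho> ^ n / (qpoch q (\<rho>\<^sup>2) n * qfact q n) * B_poly q n y * al_salam_chihara q \<rho> y n x)"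
    using D0 by (simp add: field_simps)
qed

end
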